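(* Let $A$ be an expanding integer $n\times n$ matrix, let $D\subset\mathbb{Z}^n$ be a nonempty finite subset, and let $T=T(A,D)$ be the associated self-affine set. Let $K\supset D$ be the finite set, $C\subset K$ the coset transversal for $\mathbb{Z}^n/A(\mathbb{Z}^n)$, $\mathcal{N}_D$ the finite labeled graph, $F_v\subset C^{-\omega}$ (for $v$ a vertex of $\mathcal{N}_D$) the sets, and $\mu$ the uniform Bernoulli measure on $C^{-\omega}$, all as defined in the context. Then the Lebesgue measure of $T$ is \[ \lambda(T)=\sum_{v\in \mathcal{N}_D}\mu(F_v), \] where the sum is over all vertices $v$ of $\mathcal{N}_D$.
   Context: An integer matrix $A$ is expanding if every eigenvalue of $A$ has modulus greater than $1$. For a finite nonempty set $D\subset\mathbb{Z}^n$, the self-affine set $T=T(A,D)\subset\mathbb{R}^n$ is the unique nonempty compact set with $A(T)=\bigcup_{d\in D}(T+d)$; explicitly $T=\{\sum_{k=1}^\infty A^{-k}d_k : d_k\in D\}$. $\lambda$ denotes Lebesgue measure on $\mathbb{R}^n$. Choice of $K$ and $C$: if $D$ contains representatives of all cosets of $\mathbb{Z}^n/A(\mathbb{Z}^n)$, put $K=D$; otherwise let $K\subset\mathbb{Z}^n$ be any finite set with $K\supset D$ that contains representatives of all cosets. Let $C\subset K$ be any coset transversal for $\mathbb{Z}^n/A(\mathbb{Z}^n)$ (exactly one representative of each coset). The directed labeled graph $\Gamma=\Gamma(A,K)$ has vertex set $\mathbb{Z}^n$, and for $u,v\in\mathbb{Z}^n$ and $x,y\in K$ there is a directed edge from $u$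 to $v$ labeled by $(x,y)$ if and only if $u+x=y+Av$. The nucleus $\mathcal{N}$ of $\Gamma$ is the subgraph spanned by all (directed) cycles of $\Gamma$ and all vertices that can be reached by following directed paths from the cycles; it is a finite graph. The graph $\mathcal{N}_D$ is obtained from $\mathcal{N}$ (keeping its vertices) by removing every edge whose label is not in $C\times D$ and replacing every remaining label $(a,b)$ by $a$. So edges of $\mathcal{N}_D$ are labeled by elements of $C$. $C^{-\omega}$ is the space of all left-infinite sequences $\ldots x_2x_1$ with $x_i\in C$, with the product topology of discrete sets; $\mu$ is the uniform Bernoulli measure on $C^{-\omega}$, i.e. the product measure with $\mu(x)=1/|C|$ for each $x\in C$. For a vertex $v$ of $\mathcal{N}_D$, $F_v\subset C^{-\omega}$ is the set of all left-infinite sequences $\ldots x_2x_1$ that can be read along left-infinite directed paths $\cdots\xrightarrow{x_3}v_2\xrightarrow{x_2}v_1\xrightarrow{x_1}v$ in $\mathcal{N}_D$ ending in $v$. The sets $F_v$ are closed, hence measurable. *)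

theory Defs
  imports "HOL-Analysis.Analysis" "HOL-Probability.Probability"
begin

definition expanding :: "int^'n^'n \<Rightarrow> bool" where
  "expanding A \<longleftrightarrow>
     (\<forall>(c::complex) (v::complex^'n).
        v \<noteq> 0 \<and> map_matrix of_int A *v v = c *s v \<longrightarrow> cmod c > 1)"

definition real_vec :: "int^'n \<Rightarrow> real^'n" where
  "real_vec d = (\<chi> i. real_of_int (d $ i))"

(* Powers of the inverse are iterates of the linear map: the operation (^) on the type
   of matrices is componentwise.  The digit d_k of the usual numbering k = 1, 2, ...
   is d (k - 1) here. *)
definition self_affine_set :: "int^'n^'n \<Rightarrow> (int^'n) set \<Rightarrow> (real^'n) set" where
  "self_affine_set A D =
     {t. \<exists>d::nat \<Rightarrow> int^'n. range d \<subseteq> D \<and>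
         (\<lambda>k. (((*v) (matrix_inv (map_matrix real_of_int A))) ^^ Suc k) (real_vec (d k))) sums t}"

definition same_coset :: "int^'n^'n \<Rightarrow> int^'n \<Rightarrow> int^'n \<Rightarrow> bool" where
  "same_coset A u v \<longleftrightarrow> u - v \<in> range ((*v) A)"

definition represents_all_cosets :: "int^'n^'n \<Rightarrow> (int^'n) set \<Rightarrow> bool" where
  "represents_all_cosets A K \<longleftrightarrow> (\<forall>z. \<exists>k\<in>K. same_coset A z k)"

definition coset_transversal :: "int^'n^'n \<Rightarrow> (int^'n) set \<Rightarrow> bool" where
  "coset_transversal A C \<longleftrightarrow> (\<forall>z. \<exists>!c. c \<in> C \<and> same_coset A z c)"

(* An edge from u to v with label l is the triple (u, l, v). *)
definition Gamma_edges ::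
  "int^'n^'n \<Rightarrow> (int^'n) set \<Rightarrow> ((int^'n) \<times> ((int^'n) \<times> (int^'n)) \<times> (int^'n)) set" where
  "Gamma_edges A K = {(u, (x, y), v) | u x y v. x \<in> K \<and> y \<in> K \<and> u + x = y + A *v v}"

definition adjacency :: "('v \<times> 'l \<times> 'v) set \<Rightarrow> ('v \<times> 'v) set" where
  "adjacency E = {(u, v). \<exists>l. (u, l, v) \<in> E}"

(* u lies on a directed cycle (loops included) iff (u, u) is in the transitive closure. *)
definition nucleus_verts :: "int^'n^'n \<Rightarrow> (int^'n) set \<Rightarrow> (int^'n) set" where
  "nucleus_verts A K =
     {v. \<exists>u. (u, u) \<in> (adjacency (Gamma_edges A K))\<^sup>+ \<and>
             (u, v) \<in> (adjacency (Gamma_edges A K))\<^sup>*}"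

definition nucleus_edges ::
  "int^'n^'n \<Rightarrow> (int^'n) set \<Rightarrow> ((int^'n) \<times> ((int^'n) \<times> (int^'n)) \<times> (int^'n)) set" where
  "nucleus_edges A K =
     {(u, l, v) \<in> Gamma_edges A K. u \<in> nucleus_verts A K \<and> v \<in> nucleus_verts A K}"

definition ND_edges ::
  "int^'n^'n \<Rightarrow> (int^'n) set \<Rightarrow> (int^'n) set \<Rightarrow> (int^'n) set \<Rightarrow>
     ((int^'n) \<times> (int^'n) \<times> (int^'n)) set" where
  "ND_edges A K C D =
     {(u, a, v) | u a v. \<exists>b. (u, (a, b), v) \<in> nucleus_edges A K \<and> (a, b) \<in> C \<times> D}"

(* A left-infinite sequence ... x_2 x_1 is a function x on nat, with x_k stored as x (k - 1);
   a path is the function w of its vertices, with endpoint w 0. *)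
definition F :: "int^'n^'n \<Rightarrow> (int^'n) set \<Rightarrow> (int^'n) set \<Rightarrow> (int^'n) set \<Rightarrow> int^'n \<Rightarrow>
     (nat \<Rightarrow> int^'n) set" where
  "F A K C D v =
     {x. \<exists>w. w 0 = v \<and> (\<forall>k. (w (Suc k), x k, w k) \<in> ND_edges A K C D)}"

definition bernoulli :: "'a set \<Rightarrow> (nat \<Rightarrow> 'a) measure" where
  "bernoulli C = (\<Pi>\<^sub>M k\<in>UNIV. uniform_count_measure C)"

end

theory Submission
  imports Defs "HOL-Complex_Analysis.Laurent_Convergence"
begin

text \<open>
  Write \<open>radix x = (\<Sum>k. A\<^sup>-\<^sup>k\<^sup>-\<^sup>1 x\<^sub>k)\<close> for a sequence of digits; the self-affine set \<open>T\<close> is the image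
  under \<open>radix\<close> of the sequences over \<open>D\<close>.  An edge \<open>u + x = y + A v\<close> says that
  \<open>v = A\<^sup>-\<^sup>1 (u + x - y)\<close>, so iterating backwards along a bounded left-infinite path ending in \<open>v\<close>
  with labels \<open>(x\<^sub>k, y\<^sub>k)\<close> gives \<open>v = radix x - radix y\<close>.  Conversely such an equation produces a
  bounded path, and a bounded path runs inside the nucleus.  Hence \<open>F v\<close> consists of the sequences
  \<open>x\<close> over \<open>C\<close> with \<open>radix x - v \<in> T\<close>, and there are no such sequences for \<open>v\<close> outside the
  nucleus (\<open>F_subset_radix_translate\<close>, \<open>radix_translate_subset_F\<close>).

  The sum in the theorem is therefore the mass of \<open>T\<close> under the measure that adds up, over all
  integer vectors \<open>v\<close>, the distributions of \<open>radix x - v\<close> for a Bernoulli sequence \<open>x\<close> over \<open>C\<close>.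
  It remains to see that this measure is Lebesgue measure (\<open>lattice_measure_eq_lborel\<close>).  It is
  invariant under integer translations.  Since \<open>C\<close> is a transversal, it is scaled by the factor
  \<open>card C\<close> under \<open>A\<close> (\<open>lattice_measure_contraction\<close>), so it is invariant under the finer
  lattices \<open>A\<^sup>-\<^sup>k \<int>\<^sup>n\<close> as well, and their union is dense.  A measure of this form with a dense
  set of invariant translations is Lebesgue measure: averaging it over the translations by a unit
  cube gives Lebesgue measure in any case, and here the averaging changes nothing
  (\<open>periodization_eq_lborel\<close>).

  The eigenvalue hypothesis enters through the invertibility of \<open>A\<close> and through a norm for which
  \<open>A\<^sup>-\<^sup>1\<close> is a strict contraction (\<open>adapted_norm\<close>).
\<close>

section \<open>The inverse of an expanding matrix is a contraction\<close>

(* The symbol is reserved for components of vectors. *)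
no_notation fps_nth (infixl "$" 75)

lemma mat_mult_vec: "mat c *v v = c *s (v :: 'a::comm_semiring_1^'n)"
  by (simp add: vec_eq_iff matrix_vector_mult_def mat_def if_distrib[of "\<lambda>x. x * _"] cong: if_cong)

lemma diff_mat_nth: "(M - mat z) $ i $ j = M $ i $ j - (if i = j then z else (0::'a::ring_1))"
  by (simp add: mat_def)

text \<open>
  The determinant of \<open>M - z\<close> has no zero on the closed unit disc, since such a zero would be an
  eigenvalue of modulus at most one.  The margin \<open>r > 1\<close> gained here by compactness is what makes
  the power series below converge at the point 1.
\<close>
lemma det_nonzero_open_ball:
  fixes M :: "complex^'n^'n"
  assumes "\<And>c v. v \<noteq> 0 \<Longrightarrow> M *v v = c *s v \<Longrightarrow> cmod c > 1"
  obtains r where "r > 1" "\<And>z. cmod z < r \<Longrightarrow> det (M - mat z) \<noteq> 0"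
proof -
  define p where "p z = det (M - mat z)" for z
  have nz: "p z \<noteq> 0" if "cmod z \<le> 1" for z
  proof
    assume "p z = 0"
    then have "\<not> invertible (M - mat z)"
      by (simp add: invertible_det_nz p_def)
    then obtain v where "v \<noteq> 0" "(M - mat z) *v v = 0"
      unfolding invertible_left_inverse matrix_left_invertible_ker by metis
    then have "M *v v = z *s v"
      by (simp add: matrix_vector_mult_diff_rdistrib mat_mult_vec)
    with assms \<open>v \<noteq> 0\<close> that show False by force
  qed
  have cont: "continuous_on UNIV p"
  proof -
    have c: "continuous_on UNIV (\<lambda>z::complex. if i = j then z else 0)" for i j :: 'n
      by (cases "i = j") (auto intro!: continuous_intros)
    then show ?thesis
      unfolding p_def det_def diff_mat_nth by (intro continuous_intros c)
  qed
  have "open {z. p z \<noteq> 0}"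
    using open_Collect_neq [OF cont continuous_on_const [of _ 0]] by simp
  moreover have "cball 0 1 \<subseteq> {z. p z \<noteq> 0}"
    using nz by auto
  ultimately obtain e where e: "e > 0" "(\<Union>x\<in>cball (0::complex) 1. cball x e) \<subseteq> {z. p z \<noteq> 0}"
    using compact_subset_open_imp_cball_epsilon_subset[of "cball (0::complex) 1"]
    by (metis compact_cball)
  have "p z \<noteq> 0" if z: "cmod z < 1 + e" for z
  proof (cases "cmod z \<le> 1")
    case False
    have "z \<in> cball (sgn z) e"
    proof -
      have z0: "z \<noteq> 0" using False by auto
      then have "cmod z *\<^sub>R sgn z = z" by (simp add: sgn_div_norm)
      then have "z - sgn z = (cmod z - 1) *\<^sub>R sgn z"
        by (simp add: scaleR_left_diff_distrib)
      then have "norm (z - sgn z) = cmod z - 1"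
        using False z0 by (simp add: norm_sgn)
      then show ?thesis using z by (simp add: dist_norm norm_minus_commute)
    qed
    moreover have "sgn z \<in> cball 0 1" by (simp add: norm_sgn)
    ultimately show ?thesis using e by blast
  qed (use nz in auto)
  then show ?thesis using that[of "1+e"] e p_def by auto
qed

text \<open>
  The vectors \<open>a k\<close> are the inverse iterates \<open>M\<^sup>-\<^sup>k\<^sup>-\<^sup>1 b\<close>.  By Cramer's rule the solution \<open>f z\<close> of
  \<open>(M - z) f z = b\<close> has entries that are rational functions of \<open>z\<close> without poles in a disc of
  radius greater than 1, so their Taylor series converge absolutely at 1.  Comparing Taylor
  coefficients on both sides of the equation identifies the coefficients with the inverse iterates.
  The argument plays the role of Gelfand's spectral radius formula.
\<close>
lemma inverse_iterates_summable_complex: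
  fixes M :: "complex^'n^'n"
  assumes "\<And>c v. v \<noteq> 0 \<Longrightarrow> M *v v = c *s v \<Longrightarrow> cmod c > 1"
  obtains a where "M *v a 0 = b" "\<And>k. M *v a (Suc k) = a k" "\<And>i. summable (\<lambda>k. cmod (a k $ i))"
proof -
  obtain r where r: "r > 1" "\<And>z. cmod z < r \<Longrightarrow> det (M - mat z) \<noteq> 0"
    by (rule det_nonzero_open_ball[of M]) (use assms in auto)
  define f where "f z = (\<chi> k. det (\<chi> i j. if j = k then b $ i else (M - mat z) $ i $ j) / det (M - mat z))" for z
  have f: "(M - mat z) *v f z = b" if "cmod z < r" for z
    using cramer[OF r(2)[OF that]] unfolding f_def by blast
  have eq: "(\<Sum>j\<in>UNIV. M $ i $ j * f z $ j) - z * f z $ i = b $ i" if "cmod z < r" for z i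
  proof -
    have "(mat z *v f z) $ i = z * f z $ i"
      by (simp add: mat_mult_vec)
    then show ?thesis
      using arg_cong[OF f[OF that], of "\<lambda>v. v $ i"]
      by (simp add: matrix_vector_mult_diff_rdistrib) (simp add: matrix_vector_mult_def)
  qed
  have hol: "(\<lambda>z. f z $ i) holomorphic_on ball 0 r" for i
  proof -
    have e: "(\<lambda>z::complex. if i = j then z else 0) holomorphic_on ball 0 r" for i j :: 'n
      by (cases "i = j") (auto intro!: holomorphic_intros)
    have d: "(\<lambda>z. det (M - mat z)) holomorphic_on ball 0 r"
      unfolding det_def diff_mat_nth by (intro holomorphic_intros e)
    have e': "(\<lambda>z. if j = k then b $ i else M $ i $ j - (if i = j then z else 0)) holomorphic_on ball 0 r" for i j k
      using holomorphic_on_diff[OF holomorphic_on_const e[of i j]] by (cases "j = k") auto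
    have n: "(\<lambda>z. det (\<chi> i j. if j = k then b $ i else (M - mat z) $ i $ j)) holomorphic_on ball 0 r" for k
      unfolding det_def diff_mat_nth vec_lambda_beta by (intro holomorphic_intros e')
    show ?thesis unfolding f_def using r(2) by (auto intro!: holomorphic_on_divide d n)
  qed
  define Fi where "Fi i = fps_expansion (\<lambda>z. f z $ i) 0" for i
  have F: "(\<lambda>z. f z $ i) has_fps_expansion Fi i" for i
    unfolding Fi_def using hol[of i] r(1) by (intro has_fps_expansion_fps_expansion[of "ball 0 r"]) auto
  have feq: "(\<Sum>j\<in>UNIV. fps_const (M $ i $ j) * Fi j) - fps_X * Fi i = fps_const (b $ i)" for i
  proof (rule fps_expansion_unique_complex)
    show "(\<lambda>z. (\<Sum>j\<in>UNIV. M $ i $ j * f z $ j) - z * f z $ i) has_fps_expansion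
        (\<Sum>j\<in>UNIV. fps_const (M $ i $ j) * Fi j) - fps_X * Fi i"
      by (intro fps_expansion_intros F)
    have "\<forall>\<^sub>F z in nhds 0. z \<in> ball 0 r"
      using r(1) by (intro eventually_nhds_in_open) auto
    then have "\<forall>\<^sub>F z in nhds 0. (\<Sum>j\<in>UNIV. M $ i $ j * f z $ j) - z * f z $ i = b $ i"
      by eventually_elim (use eq in auto)
    then show "(\<lambda>z. (\<Sum>j\<in>UNIV. M $ i $ j * f z $ j) - z * f z $ i) has_fps_expansion fps_const (b $ i)"
      by (subst has_fps_expansion_cong[OF _ refl]) auto
  qed
  define a where "a k = (\<chi> i. fps_nth (Fi i) k)" for k
  have nth: "(M *v a k) $ i = (\<Sum>j\<in>UNIV. M $ i $ j * fps_nth (Fi j) k)" for k i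
    by (simp add: a_def matrix_vector_mult_def)
  show ?thesis
  proof
    show "M *v a 0 = b"
    proof -
      have "(M *v a 0) $ i = b $ i" for i
        using arg_cong[OF feq[of i], of "\<lambda>F. fps_nth F 0"] unfolding nth
        by (simp add: fps_sum_nth)
      then show ?thesis by (simp add: vec_eq_iff)
    qed
    show "M *v a (Suc k) = a k" for k
    proof -
      have "(M *v a (Suc k)) $ i = a k $ i" for i
        using arg_cong[OF feq[of i], of "\<lambda>F. fps_nth F (Suc k)"] unfolding nth
        by (simp add: fps_sum_nth a_def)
      then show ?thesis by (simp add: vec_eq_iff)
    qed
    show "summable (\<lambda>k. cmod (a k $ i))" for i
    proof -
      have "fps_conv_radius (Fi i) \<ge> ereal r"
        by (rule holomorphic_on_imp_fps_conv_radius_ge[OF F]) (use hol in auto)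
      moreover have "ereal 1 < ereal r" using r by simp
      ultimately have "ereal (norm (1::complex)) < fps_conv_radius (Fi i)"
        by (metis norm_one order_less_le_trans)
      then have "summable (\<lambda>k. norm (fps_nth (Fi i) k * 1 ^ k))"
        unfolding fps_conv_radius_def by (rule abs_summable_in_conv_radius)
      then show ?thesis by (simp add: a_def)
    qed
  qed
qed

definition real_mat :: "int^'n^'n \<Rightarrow> real^'n^'n" where
  "real_mat A = map_matrix real_of_int A"

text \<open>
  This is the map whose iterates occur in the definition of the self-affine set.  It need not shrink
  the Euclidean norm; it shrinks the adapted norm constructed below.
\<close>
definition contraction :: "int^'n^'n \<Rightarrow> real^'n \<Rightarrow> real^'n" where
  "contraction A = (*v) (matrix_inv (real_mat A))"

text \<open>
  A real vector in the kernel would be a complex eigenvector with eigenvalue 0.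
\<close>
lemma real_mat_injective:
  fixes A :: "int^'n^'n"
  assumes "expanding A" "real_mat A *v x = 0"
  shows "x = 0"
proof (rule ccontr)
  assume "x \<noteq> 0"
  define v where "v = (\<chi> i. complex_of_real (x $ i))"
  have "map_matrix of_int A *v v = 0 *s v"
  proof -
    have "(map_matrix of_int A *v v) $ i = complex_of_real ((real_mat A *v x) $ i)" for i
      by (simp add: v_def matrix_vector_mult_def real_mat_def)
    then show ?thesis using assms by (simp add: vec_eq_iff)
  qed
  moreover have "v \<noteq> 0" using \<open>x \<noteq> 0\<close> by (auto simp: v_def vec_eq_iff)
  ultimately show False using assms(1) unfolding expanding_def by force
qed

lemma real_mat_contraction:
  assumes "expanding A"
  shows "real_mat A *v contraction A x = x" "contraction A (real_mat A *v x) = x"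
proof -
  have "invertible (real_mat A)"
    unfolding invertible_left_inverse matrix_left_invertible_ker
    using real_mat_injective[OF assms] by blast
  then have "real_mat A ** matrix_inv (real_mat A) = mat 1 \<and> matrix_inv (real_mat A) ** real_mat A = mat 1"
    unfolding invertible_def matrix_inv_def by (rule someI_ex)
  then show "real_mat A *v contraction A x = x" "contraction A (real_mat A *v x) = x"
    by (simp_all add: contraction_def matrix_vector_mul_assoc)
qed

lemma linear_contraction_funpow: "linear (contraction A ^^ k)"
proof (induction k)
  case (Suc k)
  have "linear (contraction A)" unfolding contraction_def by simp
  from linear_compose[OF Suc this] show ?case by (simp only: funpow.simps)
qed (simp add: linear_id[unfolded id_def] id_def)

text \<open>
  Complexify \<open>x\<close>.  As the complexified matrix is injective too (0 is not an eigenvalue), the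
  complex inverse iterates are the complexifications of the real ones.
\<close>
lemma contraction_funpow_summable:
  fixes A :: "int^'n^'n"
  assumes "expanding A"
  shows "summable (\<lambda>k. norm ((contraction A ^^ k) x))"
proof -
  have A: "cmod c > 1" if "v \<noteq> 0" "map_matrix of_int A *v v = c *s v" for c :: complex and v :: "complex^'n"
    using assms that unfolding expanding_def by blast
  obtain a where a: "map_matrix of_int A *v a 0 = (\<chi> i. complex_of_real (x $ i))"
    "\<And>k. map_matrix of_int A *v a (Suc k) = a k" "\<And>i. summable (\<lambda>k. cmod (a k $ i))"
    by (rule inverse_iterates_summable_complex[of "map_matrix of_int A" "\<chi> i. complex_of_real (x $ i)"])
      (use A in auto)
  have inj: "v = (\<chi> i. complex_of_real (contraction A y $ i))"
    if "map_matrix of_int A *v v = (\<chi> i. complex_of_real (y $ i))" for v :: "complex^'n" and y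
  proof (rule ccontr)
    define w where "w = v - (\<chi> i. complex_of_real (contraction A y $ i))"
    assume "\<not> ?thesis"
    then have "w \<noteq> 0" by (simp add: w_def)
    moreover have "map_matrix of_int A *v (\<chi> i. complex_of_real (contraction A y $ i))
        = (\<chi> i. complex_of_real (y $ i))"
    proof -
      have "(map_matrix of_int A *v (\<chi> i. complex_of_real (contraction A y $ i))) $ j
          = complex_of_real ((real_mat A *v contraction A y) $ j)" for j
        by (simp add: matrix_vector_mult_def real_mat_def)
      then show ?thesis using real_mat_contraction(1)[OF assms] by (simp add: vec_eq_iff)
    qed
    then have "map_matrix of_int A *v w = 0 *s w"
      unfolding w_def using that by (simp add: matrix_vector_mult_diff_distrib)
    ultimately show False using A by force
  qed
  have ak: "a k = (\<chi> i. complex_of_real ((contraction A ^^ Suc k) x $ i))" for k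
  proof (induction k)
    case 0
    then show ?case using inj[OF a(1)] by simp
  next
    case (Suc k)
    then show ?case using inj[of "a (Suc k)" "(contraction A ^^ Suc k) x"] a(2) by simp
  qed
  have "summable (\<lambda>k. \<Sum>i\<in>UNIV. \<bar>(contraction A ^^ Suc k) x $ i\<bar>)"
    using a(3) unfolding ak by (intro summable_sum) (simp add: norm_of_real)
  then have "summable (\<lambda>k. norm ((contraction A ^^ Suc k) x))"
    by (rule summable_comparison_test'[where N=0]) (use norm_le_l1_cart in auto)
  then show ?thesis by (subst (asm) summable_Suc_iff)
qed

text \<open>
  Take \<open>N x = (\<Sum>k. norm (A\<^sup>-\<^sup>k x))\<close>.  Dropping the first term gives \<open>N (A\<^sup>-\<^sup>1 x) = N x - norm x\<close>, and
  since \<open>norm x\<close> is at least a fixed proportion of \<open>N x\<close>, the map contracts \<open>N\<close> by a constant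
  factor.
\<close>
lemma adapted_norm:
  fixes A :: "int^'n^'n"
  assumes "expanding A"
  obtains N :: "real^'n \<Rightarrow> real" and \<theta> K where
    "0 \<le> \<theta>" "\<theta> < 1" "\<And>x. norm x \<le> N x" "\<And>x. N x \<le> K * norm x"
    "\<And>x y. N (x + y) \<le> N x + N y" "\<And>x. N (contraction A x) \<le> \<theta> * N x"
proof -
  define N where "N x = (\<Sum>k. norm ((contraction A ^^ k) x))" for x
  note S = contraction_funpow_summable[OF assms]
  have N_le: "norm x \<le> N x" for x
    unfolding N_def using sum_le_suminf[OF S[of x], of "{0}"] by simp
  have N_add: "N (x + y) \<le> N x + N y" for x y
    unfolding N_def suminf_add[OF S S]
    by (rule suminf_le[OF _ S summable_add[OF S S]])
      (simp add: linear_add[OF linear_contraction_funpow] norm_triangle_ineq)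
  have N_scale: "N (c *\<^sub>R x) = \<bar>c\<bar> * N x" for c x
    unfolding N_def by (simp add: linear_scale[OF linear_contraction_funpow] suminf_mult[OF S])
  have N_contr: "N (contraction A x) = N x - norm x" for x
    unfolding N_def using suminf_split_head[OF S[of x]] by (simp add: funpow_swap1)
  define K where "K = 1 + (\<Sum>b\<in>Basis. N (b::real^'n))"
  have N0: "N x \<ge> 0" for x using N_le[of x] norm_ge_zero[of x] by linarith
  have K1: "K \<ge> 1" unfolding K_def using N0 by (simp add: sum_nonneg)
  have N_sum: "N (sum f I) \<le> (\<Sum>i\<in>I. N (f i))" if "finite I" for f and I :: "(real^'n) set"
    using that
  proof (induction I)
    case empty
    have "N 0 = 0" using N_scale[of 0 0] by simp
    then show ?case by simp
  next
    case (insert i I)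
    then show ?case using N_add[of "f i" "sum f I"] by simp
  qed
  have N_ub: "N x \<le> K * norm x" for x
  proof -
    have "N x = N (\<Sum>b\<in>Basis. (x \<bullet> b) *\<^sub>R b)" by (simp add: euclidean_representation)
    also have "\<dots> \<le> (\<Sum>b\<in>Basis. N ((x \<bullet> b) *\<^sub>R b))" by (rule N_sum) simp
    also have "\<dots> \<le> (\<Sum>b\<in>Basis. norm x * N b)"
      unfolding N_scale by (intro sum_mono mult_right_mono N0 Basis_le_norm)
    also have "\<dots> \<le> K * norm x" by (simp add: K_def sum_distrib_left algebra_simps)
    finally show ?thesis .
  qed
  have "N (contraction A x) \<le> (1 - 1/K) * N x" for x
  proof -
    have "N x / K \<le> norm x"
      using N_ub[of x] K1 by (simp add: pos_divide_le_eq mult.commute)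
    then show ?thesis using N_contr[of x] by (simp add: left_diff_distrib)
  qed
  then show ?thesis using that[of "1 - 1/K" N K] N_le N_add N_ub K1 by simp
qed

lemma contraction_funpow_bounded_tendsto_0:
  fixes A :: "int^'n^'n" and y :: "nat \<Rightarrow> real^'n"
  assumes "expanding A" and bound: "\<And>k. norm (y k) \<le> b"
  shows "(\<lambda>k. (contraction A ^^ k) (y k)) \<longlonglongrightarrow> 0"
proof -
  obtain N :: "real^'n \<Rightarrow> real" and \<theta> K where N:
    "0 \<le> \<theta>" "\<theta> < 1" "\<And>x. norm x \<le> N x" "\<And>x. N x \<le> K * norm x"
    "\<And>x. N (contraction A x) \<le> \<theta> * N x"
    using adapted_norm[OF assms(1)] by metis
  have pow: "N ((contraction A ^^ k) x) \<le> \<theta> ^ k * N x" for k x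
  proof (induction k)
    case (Suc k)
    have "N ((contraction A ^^ Suc k) x) \<le> \<theta> * N ((contraction A ^^ k) x)"
      using N(5) by simp
    also have "\<dots> \<le> \<theta> * (\<theta> ^ k * N x)" using Suc N(1) by (rule mult_left_mono)
    finally show ?case by simp
  qed simp
  have "N (y k) \<le> \<bar>K\<bar> * b" for k
  proof -
    have "N (y k) \<le> \<bar>K\<bar> * norm (y k)"
      using N(4)[of "y k"] by (meson abs_ge_self mult_right_mono norm_ge_zero order_trans)
    also have "\<dots> \<le> \<bar>K\<bar> * b" using bound[of k] by (simp add: mult_left_mono)
    finally show ?thesis .
  qed
  then have le: "norm ((contraction A ^^ k) (y k)) \<le> \<theta> ^ k * (\<bar>K\<bar> * b)" for k
    using N(1) by (intro order_trans[OF N(3)] order_trans[OF pow] mult_left_mono) auto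
  have "(\<lambda>k. \<theta> ^ k * (\<bar>K\<bar> * b)) \<longlonglongrightarrow> 0"
    using N(1,2) by (intro tendsto_mult_left_zero LIMSEQ_power_zero) auto
  then show ?thesis
    by (rule Lim_null_comparison[rotated]) (use le in auto)
qed

section \<open>Digit expansions\<close>

text \<open>
  This rigidity principle identifies the endpoint of a bounded left-infinite path with the difference
  of the two digit expansions along it.
\<close>
lemma bounded_backward_orbit_zero:
  fixes A :: "int^'n^'n" and R :: "nat \<Rightarrow> real^'n"
  assumes "expanding A" and step: "\<And>k. R k = contraction A (R (Suc k))"
    and bound: "\<And>k. norm (R k) \<le> b"
  shows "R 0 = 0"
proof -
  have "R 0 = (contraction A ^^ k) (R k)" for k
    by (induction k) (simp_all add: funpow_swap1 step[symmetric])
  then have "(\<lambda>k. R 0) = (\<lambda>k. (contraction A ^^ k) (R k))" by blast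
  then have "(\<lambda>k. R 0) \<longlonglongrightarrow> 0"
    using contraction_funpow_bounded_tendsto_0[where y = R, OF assms(1) bound] by simp
  then show ?thesis by (simp add: LIMSEQ_const_iff)
qed

lemma linear_contraction: "linear (contraction A)"
  using linear_contraction_funpow[where A=A and k=1] by simp

lemma real_vec_simps [simp]:
  "real_vec (u + v) = real_vec u + real_vec v" "real_vec (u - v) = real_vec u - real_vec v"
  "real_vec (A *v v) = real_mat A *v real_vec v"
  by (simp_all add: real_vec_def real_mat_def vec_eq_iff matrix_vector_mult_def)

lemma inj_real_vec: "inj real_vec"
  by (rule injI) (simp add: real_vec_def vec_eq_iff)

lemma finite_bounded_int_vecs: "finite {v :: int^'n. norm (real_vec v) \<le> r}"
proof -
  have "v \<in> vec_lambda ` (UNIV \<rightarrow>\<^sub>E {-\<lceil>r\<rceil>..\<lceil>r\<rceil>})" if "norm (real_vec v) \<le> r" for v :: "int^'n"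
  proof -
    have "v $ i \<in> {-\<lceil>r\<rceil>..\<lceil>r\<rceil>}" for i
    proof -
      have "\<bar>real_of_int (v $ i)\<bar> \<le> r"
        using component_le_norm_cart[of "real_vec v" i] that by (simp add: real_vec_def)
      then show ?thesis by (auto simp: abs_le_iff) linarith+
    qed
    then show ?thesis by (intro image_eqI[of _ _ "\<lambda>i. v $ i"]) auto
  qed
  then have "{v :: int^'n. norm (real_vec v) \<le> r} \<subseteq> vec_lambda ` (UNIV \<rightarrow>\<^sub>E {-\<lceil>r\<rceil>..\<lceil>r\<rceil>})"
    by blast
  then show ?thesis by (rule finite_subset) (intro finite_imageI finite_PiE, auto)
qed

definition radix :: "int^'n^'n \<Rightarrow> (nat \<Rightarrow> int^'n) \<Rightarrow> real^'n" where
  "radix A d = (\<Sum>k. (contraction A ^^ Suc k) (real_vec (d k)))"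

text \<open>
  The summands of a digit expansion are bounded by this summable sequence, uniformly in the digits.
\<close>
definition majorant :: "int^'n^'n \<Rightarrow> (int^'n) set \<Rightarrow> nat \<Rightarrow> real" where
  "majorant A E k = (\<Sum>e\<in>E. norm ((contraction A ^^ Suc k) (real_vec e)))"

lemma summable_majorant: "expanding A \<Longrightarrow> summable (majorant A E)"
  unfolding majorant_def
  by (intro summable_sum) (subst summable_Suc_iff, rule contraction_funpow_summable)

lemma norm_le_majorant:
  "finite E \<Longrightarrow> e \<in> E \<Longrightarrow> norm ((contraction A ^^ Suc k) (real_vec e)) \<le> majorant A E k"
  unfolding majorant_def by (rule member_le_sum) auto

lemma
  assumes "expanding A" "finite E" "range d \<subseteq> E"
  shows radix_summable: "summable (\<lambda>k. (contraction A ^^ Suc k) (real_vec (d k)))"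
    and norm_radix_le: "norm (radix A d) \<le> suminf (majorant A E)"
proof -
  have le: "norm ((contraction A ^^ Suc k) (real_vec (d k))) \<le> majorant A E k" for k
    using assms by (intro norm_le_majorant) auto
  then have s: "summable (\<lambda>k. norm ((contraction A ^^ Suc k) (real_vec (d k))))"
    by (intro summable_comparison_test'[OF summable_majorant[OF assms(1)], of 0 _ E]) simp
  then show "summable (\<lambda>k. (contraction A ^^ Suc k) (real_vec (d k)))"
    by (rule summable_norm_cancel)
  have "norm (radix A d) \<le> (\<Sum>k. norm ((contraction A ^^ Suc k) (real_vec (d k))))"
    unfolding radix_def by (rule summable_norm[OF s])
  also have "\<dots> \<le> suminf (majorant A E)"
    by (intro suminf_le le s summable_majorant assms)
  finally show "norm (radix A d) \<le> suminf (majorant A E)" .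
qed

lemma self_affine_set_eq_radix_image:
  assumes "expanding A" "finite D"
  shows "self_affine_set A D = radix A ` {d. range d \<subseteq> D}"
  using radix_summable[OF assms]
  unfolding self_affine_set_def radix_def contraction_def[symmetric] real_mat_def[symmetric]
  by (auto simp: sums_iff)

text \<open>
  The self-similarity behind everything that follows: dropping the first digit amounts to applying
  \<open>A\<close> and subtracting that digit.
\<close>
lemma radix_unfold:
  assumes "expanding A" "finite E" "range d \<subseteq> E"
  shows "radix A d = contraction A (real_vec (d 0) + radix A (\<lambda>k. d (Suc k)))"
proof -
  have bl: "bounded_linear (contraction A)"
    using linear_contraction linear_conv_bounded_linear by blast
  have s: "summable (\<lambda>k. (contraction A ^^ Suc k) (real_vec (d (Suc k))))"
    using assms by (intro radix_summable[of A E]) auto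
  have "radix A d = contraction A (real_vec (d 0)) + (\<Sum>k. contraction A ((contraction A ^^ Suc k) (real_vec (d (Suc k)))))"
    unfolding radix_def using suminf_split_head[OF radix_summable[OF assms]] by simp
  also have "(\<Sum>k. contraction A ((contraction A ^^ Suc k) (real_vec (d (Suc k))))) = contraction A (radix A (\<lambda>k. d (Suc k)))"
    unfolding radix_def by (rule bounded_linear.suminf[OF bl s, symmetric])
  finally show ?thesis by (simp add: linear_add[OF linear_contraction])
qed

text \<open>
  The digit sequences form a compact product space, on which the expansion is a uniform limit of
  functions that depend on finitely many digits.
\<close>
lemma compact_self_affine_set:
  fixes A :: "int^'n^'n"
  assumes "expanding A" "finite D"
  shows "compact (self_affine_set A D)"
proof -
  define X where "X = (UNIV :: nat set) \<rightarrow>\<^sub>E real_vec ` D"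
  have "compactin (product_topology (\<lambda>_. euclidean) UNIV) X"
    unfolding X_def compactin_PiE using assms(2) by (simp add: finite_imp_compact)
  then have "compact X" by (simp add: euclidean_product_topology)
  moreover have "continuous_on X (\<lambda>x. \<Sum>k. (contraction A ^^ Suc k) (x k))"
  proof (rule uniform_limit_theorem)
    show "uniform_limit X (\<lambda>n x. \<Sum>k<n. (contraction A ^^ Suc k) (x k))
        (\<lambda>x. \<Sum>k. (contraction A ^^ Suc k) (x k)) sequentially"
    proof (rule Weierstrass_m_test)
      show "norm ((contraction A ^^ Suc k) (x k)) \<le> majorant A D k" if "x \<in> X" for k x
      proof -
        obtain e where e: "e \<in> D" "x k = real_vec e" using \<open>x \<in> X\<close> unfolding X_def by blast
        show ?thesis unfolding e(2) by (rule norm_le_majorant[OF assms(2) e(1)])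
      qed
    qed (rule summable_majorant[OF assms(1)])
    have "continuous_on X (\<lambda>x. (contraction A ^^ Suc k) (x k))" for k
    proof -
      have "continuous_on UNIV (contraction A ^^ Suc k)"
        using linear_contraction_funpow linear_conv_bounded_linear linear_continuous_on by blast
      then show ?thesis
        by (rule continuous_on_compose2) (auto intro: continuous_on_subset[OF continuous_on_product_coordinates])
    qed
    then show "\<forall>\<^sub>F n in sequentially. continuous_on X (\<lambda>x. \<Sum>k<n. (contraction A ^^ Suc k) (x k))"
      by (intro always_eventually allI continuous_on_sum)
  qed auto
  moreover have "self_affine_set A D = (\<lambda>x. \<Sum>k. (contraction A ^^ Suc k) (x k)) ` X"
  proof -
    have "X = (\<lambda>d k. real_vec (d k)) ` {d. range d \<subseteq> D}"
    proof (intro set_eqI iffI)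
      fix x assume "x \<in> X"
      then have "\<forall>k. \<exists>e. e \<in> D \<and> x k = real_vec e" unfolding X_def by blast
      then obtain d where "\<And>k. d k \<in> D \<and> x k = real_vec (d k)" by metis
      then show "x \<in> (\<lambda>d k. real_vec (d k)) ` {d. range d \<subseteq> D}"
        by (intro image_eqI[of _ _ d]) auto
    qed (auto simp: X_def)
    then show ?thesis
      unfolding self_affine_set_eq_radix_image[OF assms] by (simp add: radix_def image_image)
  qed
  ultimately show ?thesis by (simp add: compact_continuous_image)
qed

section \<open>Paths in the graph\<close>

lemma Gamma_edge_contraction:
  assumes "expanding A" "u + x = y + A *v v"
  shows "real_vec v = contraction A (real_vec u + real_vec x - real_vec y)"
proof -
  have "real_mat A *v real_vec v = real_vec u + real_vec x - real_vec y"
    using arg_cong[OF assms(2), of real_vec] by (simp add: algebra_simps)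
  then show ?thesis using real_mat_contraction(2)[OF assms(1), of "real_vec v"] by simp
qed

text \<open>
  Along an edge the adapted norm \<open>N\<close> is multiplied by at most \<open>\<theta>\<close> up to the additive error
  \<open>\<theta> * c\<close>, so the excess \<open>g\<close> of \<open>N\<close> over the fixed point \<open>L\<close> of this affine bound is multiplied
  by at most \<open>\<theta>\<close>.  On a cycle the excess must vanish, and then it vanishes on everything reachable
  from the cycle.
\<close>
lemma finite_nucleus_verts:
  fixes A :: "int^'n^'n"
  assumes "expanding A" "finite K"
  shows "finite (nucleus_verts A K)"
proof -
  obtain N :: "real^'n \<Rightarrow> real" and \<theta> M where N:
    "0 \<le> \<theta>" "\<theta> < 1" "\<And>x. norm x \<le> N x" "\<And>x. N x \<le> M * norm x"
    "\<And>x y. N (x + y) \<le> N x + N y"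
    "\<And>x. N (contraction A x) \<le> \<theta> * N x"
    using adapted_norm[OF assms(1)] by metis
  have N0: "N z \<ge> 0" for z using N(3)[of z] norm_ge_zero[of z] by linarith
  define c where "c = (\<Sum>(x,y)\<in>K\<times>K. N (real_vec x - real_vec y))"
  have c: "N (real_vec x - real_vec y) \<le> c" if "x \<in> K" "y \<in> K" for x y
    unfolding c_def using member_le_sum[of "(x,y)" "K \<times> K" "\<lambda>(x,y). N (real_vec x - real_vec y)"] that assms(2) N0
    by auto
  \<comment> \<open>Solution of \<open>L = \<theta> * (L + c)\<close>.\<close>
  define L where "L = \<theta> * c / (1 - \<theta>)"
  have L: "\<theta> * (L + c) = L" unfolding L_def using N(2) by (simp add: field_simps)
  define g where "g u = max 0 (N (real_vec u) - L)" for u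
  let ?R = "adjacency (Gamma_edges A K)"
  have edge: "g v \<le> \<theta> * g u" if uv: "(u, v) \<in> ?R" for u v
  proof -
    from uv obtain x y where xy: "x \<in> K" "y \<in> K" "u + x = y + A *v v"
      by (auto simp: adjacency_def Gamma_edges_def)
    have "N (real_vec v) \<le> \<theta> * N (real_vec u + (real_vec x - real_vec y))"
      using Gamma_edge_contraction[OF assms(1) xy(3)] N(6) by (simp add: add_diff_eq)
    also have "\<dots> \<le> \<theta> * (N (real_vec u) + c)"
      using N(5)[of "real_vec u" "real_vec x - real_vec y"] c[OF xy(1,2)] N(1) by (intro mult_left_mono) linarith+
    finally have "N (real_vec v) - L \<le> \<theta> * (N (real_vec u) - L)"
      using L by (simp add: algebra_simps)
    also have "\<dots> \<le> \<theta> * g u" unfolding g_def using N(1) by (intro mult_left_mono) auto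
    finally show ?thesis using N(1) unfolding g_def by (simp add: mult_nonneg_nonneg)
  qed
  have g0: "g u \<ge> 0" for u unfolding g_def by simp
  have le: "\<theta> * g u \<le> g u" for u using N(2) g0[of u] by (simp add: mult_left_le_one_le N(1))
  have trancl: "g v \<le> \<theta> * g u" if "(u, v) \<in> ?R\<^sup>+" for u v
    using that by induction (use edge le in \<open>meson order_trans\<close>)+
  have "norm (real_vec v) \<le> L" if "v \<in> nucleus_verts A K" for v
  proof -
    from that obtain u where u: "(u, u) \<in> ?R\<^sup>+" "(u, v) \<in> ?R\<^sup>*"
      by (auto simp: nucleus_verts_def)
    from u(1) have "g u \<le> \<theta> * g u" by (rule trancl)
    then have "(1 - \<theta>) * g u \<le> 0" by (simp add: algebra_simps)
    then have gu: "g u = 0" using N(2) g0[of u] by (simp add: mult_le_0_iff)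
    from u(2) have "g v \<le> g u"
      by (metis le order_trans rtranclD trancl order_refl)
    then show ?thesis using gu g0[of v] N(3)[of "real_vec v"] unfolding g_def by linarith
  qed
  then show ?thesis by (intro finite_subset[OF _ finite_bounded_int_vecs[of L]]) auto
qed

text \<open>
  A bounded left-infinite path of integer vectors visits some vertex twice.  It therefore runs through
  a cycle arbitrarily far back, and all its vertices are reachable from cycles.
\<close>
lemma bounded_backward_path_in_nucleus:
  fixes w :: "nat \<Rightarrow> int^'n"
  assumes edge: "\<And>k. (w (Suc k), w k) \<in> adjacency (Gamma_edges A K)"
    and bound: "\<And>k. norm (real_vec (w k)) \<le> b"
  shows "w k \<in> nucleus_verts A K"
proof -
  let ?R = "adjacency (Gamma_edges A K)"
  have path: "(w (i + m), w i) \<in> ?R\<^sup>*" for i m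
    by (induction m) (auto intro: converse_rtrancl_into_rtrancl edge)
  have "finite (w ` {k..})"
    using bound by (intro finite_subset[OF _ finite_bounded_int_vecs[of b]]) auto
  then have "\<not> inj_on w {k..}"
    using finite_imageD infinite_Ici by blast
  then obtain i j where ij: "k \<le> i" "i < j" "w i = w j"
    unfolding inj_on_def by (metis atLeast_iff linorder_neqE_nat)
  have "(w j, w (Suc i)) \<in> ?R\<^sup>*" using path[of "Suc i" "j - Suc i"] ij(2) by simp
  then have "(w i, w i) \<in> ?R\<^sup>+" using edge[of i] ij(3) by simp
  moreover have "(w i, w k) \<in> ?R\<^sup>*" using path[of k "i - k"] ij(1) by simp
  ultimately show ?thesis unfolding nucleus_verts_def by blast
qed

text \<open>
  Let \<open>y\<close> be the second labels along a path reading \<open>x\<close> and ending in \<open>v\<close>.  The defect \<open>R k\<close>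
  of the identity \<open>w k = radix x - radix y\<close> for the tails from position \<open>k\<close> on satisfies
  \<open>R k = A\<^sup>-\<^sup>1 (R (k + 1))\<close>; it is bounded because the nucleus is finite, hence it is zero.
\<close>
lemma F_subset_radix_translate:
  assumes A: "expanding A" and K: "finite K" "D \<subseteq> K" "C \<subseteq> K" and x: "x \<in> F A K C D v"
  shows "range x \<subseteq> C" and "radix A x - real_vec v \<in> self_affine_set A D"
proof -
  from x obtain w where w: "w 0 = v" "\<And>k. (w (Suc k), x k, w k) \<in> ND_edges A K C D"
    unfolding F_def by blast
  from w(2) have "\<exists>b. x k \<in> C \<and> b \<in> D \<and> w (Suc k) + x k = b + A *v w k \<and> w k \<in> nucleus_verts A K" for k
    unfolding ND_edges_def nucleus_edges_def Gamma_edges_def by fastforce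
  then obtain y where y: "\<And>k. x k \<in> C" "\<And>k. y k \<in> D" "\<And>k. w (Suc k) + x k = y k + A *v w k"
    "\<And>k. w k \<in> nucleus_verts A K" by metis
  show "range x \<subseteq> C" using y(1) by blast
  have rx: "range (\<lambda>j. x (k + j)) \<subseteq> K" and ry: "range (\<lambda>j. y (k + j)) \<subseteq> K" for k
    using y(1,2) K by auto
  obtain b where b: "\<And>v. v \<in> nucleus_verts A K \<Longrightarrow> norm (real_vec v) \<le> b"
    using finite_nucleus_verts[OF A K(1)]
    by (metis Max_ge finite_imageI image_eqI)
  define R where "R k = radix A (\<lambda>j. x (k + j)) - radix A (\<lambda>j. y (k + j)) - real_vec (w k)" for k
  have "R 0 = 0"
  proof (rule bounded_backward_orbit_zero[OF A])
    show "R k = contraction A (R (Suc k))" for k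
      unfolding R_def using radix_unfold[OF A K(1) rx[of k]] radix_unfold[OF A K(1) ry[of k]]
        Gamma_edge_contraction[OF A y(3)[of k]]
      by (simp add: linear_diff[OF linear_contraction] linear_add[OF linear_contraction])
    show "norm (R k) \<le> suminf (majorant A K) + suminf (majorant A K) + b" for k
      unfolding R_def
      by (intro norm_triangle_le_diff add_mono norm_radix_le[OF A K(1)] rx ry b y)
  qed
  moreover have "R 0 = radix A x - real_vec v - radix A y" by (simp add: R_def w(1))
  ultimately have "radix A x - real_vec v = radix A y" by simp
  moreover have "finite D" using K finite_subset by blast
  ultimately show "radix A x - real_vec v \<in> self_affine_set A D"
    using y(2) by (auto simp: self_affine_set_eq_radix_image[OF A])
qed

text \<open>
  If \<open>radix x - v = radix y\<close>, the edge equation determines the path backwards from \<open>v\<close>; its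
  vertices are differences of tails of the two expansions, so the path is bounded and lies in the
  nucleus.
\<close>
lemma radix_translate_subset_F:
  assumes A: "expanding A" and K: "finite K" "D \<subseteq> K" "C \<subseteq> K"
    and x: "range x \<subseteq> C" "radix A x - real_vec v \<in> self_affine_set A D"
  shows "v \<in> nucleus_verts A K" and "x \<in> F A K C D v"
proof -
  have "finite D" using K finite_subset by blast
  with x obtain y where y: "range y \<subseteq> D" "radix A x - real_vec v = radix A y"
    by (auto simp: self_affine_set_eq_radix_image[OF A])
  define w where "w = rec_nat v (\<lambda>k u. y k + A *v u - x k)"
  have w: "w 0 = v" "w (Suc k) + x k = y k + A *v w k" for k
    by (simp_all add: w_def)
  have xy: "x k \<in> C" "y k \<in> D" "x k \<in> K" "y k \<in> K" for k
    using x(1) y(1) K by auto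
  have rx: "range (\<lambda>j. x (k + j)) \<subseteq> K" and ry: "range (\<lambda>j. y (k + j)) \<subseteq> K" for k
    using xy by auto
  have rv: "real_vec (w k) = radix A (\<lambda>j. x (k + j)) - radix A (\<lambda>j. y (k + j))" for k
  proof (induction k)
    case 0
    then show ?case using y(2) w(1) by (simp add: algebra_simps)
  next
    case (Suc k)
    define r s where "r = radix A (\<lambda>j. x (Suc k + j))" and "s = radix A (\<lambda>j. y (Suc k + j))"
    have "real_mat A *v radix A (\<lambda>j. x (k + j)) = real_vec (x k) + r"
      "real_mat A *v radix A (\<lambda>j. y (k + j)) = real_vec (y k) + s"
      using radix_unfold[OF A K(1) rx[of k]] radix_unfold[OF A K(1) ry[of k]]
      by (simp_all add: r_def s_def real_mat_contraction[OF A])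
    then have "real_mat A *v real_vec (w k) = real_vec (x k) + r - (real_vec (y k) + s)"
      unfolding Suc by (simp add: matrix_vector_mult_diff_distrib)
    moreover have "real_vec (w (Suc k)) = real_vec (y k) + real_mat A *v real_vec (w k) - real_vec (x k)"
      using arg_cong[OF w(2)[of k], of real_vec] by (simp add: algebra_simps)
    ultimately have "real_vec (w (Suc k)) = r - s" by simp
    then show ?case by (simp add: r_def s_def)
  qed
  have edge: "(w (Suc k), (x k, y k), w k) \<in> Gamma_edges A K" for k
    using xy[of k] w(2)[of k] by (simp add: Gamma_edges_def)
  have nuc: "w k \<in> nucleus_verts A K" for k
  proof (rule bounded_backward_path_in_nucleus)
    show "(w (Suc k), w k) \<in> adjacency (Gamma_edges A K)" for k
      using edge unfolding adjacency_def by blast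
    show "norm (real_vec (w k)) \<le> suminf (majorant A K) + suminf (majorant A K)" for k
      unfolding rv by (intro norm_triangle_le_diff add_mono norm_radix_le[OF A K(1)] rx ry)
  qed
  show "v \<in> nucleus_verts A K" using nuc[of 0] w(1) by simp
  show "x \<in> F A K C D v"
    unfolding F_def ND_edges_def nucleus_edges_def
    using w(1) nuc edge xy by (intro CollectI exI[of _ w]) blast
qed

section \<open>The random digit expansion\<close>

lemma borel_measurable_contraction [measurable]: "contraction A \<in> borel_measurable borel"
  using linear_contraction linear_conv_bounded_linear linear_continuous_on
  by (intro borel_measurable_continuous_onI) blast

lemma prob_space_bernoulli: "finite C \<Longrightarrow> C \<noteq> {} \<Longrightarrow> prob_space (bernoulli C)"
  unfolding bernoulli_def by (intro prob_space_PiM prob_space_uniform_count_measure)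

lemma space_bernoulli: "space (bernoulli C) = {x. range x \<subseteq> C}"
  by (auto simp: bernoulli_def space_PiM space_uniform_count_measure PiE_def)

lemma measurable_radix [measurable]: "radix A \<in> borel_measurable (bernoulli C)"
proof -
  have "(\<lambda>x. (contraction A ^^ Suc k) (real_vec (x k))) \<in> borel_measurable (bernoulli C)" for k
    unfolding bernoulli_def
  proof (rule measurable_compose[OF measurable_component_singleton])
    show "(\<lambda>e. (contraction A ^^ Suc k) (real_vec e)) \<in> borel_measurable (uniform_count_measure C)"
      by (subst measurable_cong_sets[OF sets_uniform_count_measure_count_space refl]) simp
  qed simp
  then show ?thesis unfolding radix_def[abs_def] by (rule borel_measurable_suminf)
qed

text \<open>
  The first digit is uniform on \<open>C\<close> and independent of the remaining ones, which again form a
  Bernoulli sequence.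
\<close>
lemma nn_integral_bernoulli_unfold:
  assumes C: "finite C" "C \<noteq> {}" and f: "f \<in> borel_measurable (bernoulli C)"
  shows "(\<integral>\<^sup>+x. f x \<partial>bernoulli C) = (\<Sum>c\<in>C. ennreal (1 / card C) * (\<integral>\<^sup>+x. f (case_nat c x) \<partial>bernoulli C))"
proof -
  interpret U: prob_space "uniform_count_measure C"
    using C by (rule prob_space_uniform_count_measure)
  interpret S: sequence_space "uniform_count_measure C" ..
  interpret P: pair_sigma_finite "uniform_count_measure C" S.S ..
  have f': "f \<in> borel_measurable S.S" using f unfolding bernoulli_def .
  have U_int: "(\<integral>\<^sup>+c. g c \<partial>uniform_count_measure C) = (\<Sum>c\<in>C. ennreal (1 / card C) * g c)" for g
    unfolding uniform_count_measure_def by (rule nn_integral_point_measure_finite[OF C(1)])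
  have m: "(\<lambda>(s, \<omega>). case_nat s \<omega>) \<in> measurable (uniform_count_measure C \<Otimes>\<^sub>M S.S) S.S"
    by measurable
  have "(\<integral>\<^sup>+x. f x \<partial>S.S) = (\<integral>\<^sup>+p. f (case p of (s, \<omega>) \<Rightarrow> case_nat s \<omega>) \<partial>(uniform_count_measure C \<Otimes>\<^sub>M S.S))"
    by (subst S.PiM_iter[symmetric], subst nn_integral_distr[OF m]) (use f' in auto)
  also have "\<dots> = (\<integral>\<^sup>+c. \<integral>\<^sup>+x. f (case_nat c x) \<partial>S.S \<partial>uniform_count_measure C)"
    by (subst S.nn_integral_fst[symmetric]) (use measurable_compose[OF m f'] in auto)
  also have "\<dots> = (\<Sum>c\<in>C. ennreal (1 / card C) * (\<integral>\<^sup>+x. f (case_nat c x) \<partial>S.S))"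
    by (rule U_int)
  finally show ?thesis unfolding bernoulli_def .
qed

section \<open>Periodizing a random vector\<close>

definition unit_cube :: "(real^'n) set" where
  "unit_cube = {z. \<forall>i. 0 \<le> z $ i \<and> z $ i < 1}"

lemma sets_unit_cube [measurable]: "unit_cube \<in> sets borel"
proof -
  have "unit_cube = (\<Inter>i. {z::real^'n. 0 \<le> z $ i} \<inter> {z. z $ i < 1})"
    by (auto simp: unit_cube_def)
  also have "\<dots> \<in> sets borel"
    by (intro sets.countable_INT'' sets.Int borel_closed borel_open) (auto intro!: closed_Collect_le open_Collect_less continuous_intros)
  finally show ?thesis .
qed

lemma emeasure_unit_cube: "emeasure lborel (unit_cube :: (real^'n) set) = 1"
proof -
  have one: "(1::real^'n) \<bullet> b = 1" if "b \<in> Basis" for b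
    using that by (auto simp: Basis_vec_def inner_axis)
  have "(box 0 1 :: (real^'n) set) \<subseteq> unit_cube" "(unit_cube :: (real^'n) set) \<subseteq> cbox 0 1"
    by (auto simp: unit_cube_def mem_box_cart less_imp_le)
  then have "emeasure lborel (box 0 1 :: (real^'n) set) \<le> emeasure lborel (unit_cube :: (real^'n) set)"
    "emeasure lborel (unit_cube :: (real^'n) set) \<le> emeasure lborel (cbox 0 1 :: (real^'n) set)"
    by (auto intro!: emeasure_mono)
  moreover have "emeasure lborel (box 0 1 :: (real^'n) set) = 1"
    "emeasure lborel (cbox 0 1 :: (real^'n) set) = 1"
    using one by (simp_all add: emeasure_lborel_box_eq emeasure_lborel_cbox_eq)
  ultimately show ?thesis by simp
qed

text \<open>
  Exactly one integer translate of \<open>a\<close> lies in the half-open cube, given by the negated floors.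
\<close>
lemma unit_cube_tiling:
  fixes a :: "real^'n"
  shows "(\<integral>\<^sup>+v. indicator unit_cube (a + real_vec v) \<partial>count_space UNIV) = 1"
proof -
  define v0 :: "int^'n" where "v0 = (\<chi> i. - \<lfloor>a $ i\<rfloor>)"
  have "0 \<le> a $ i + real_of_int m \<and> a $ i + real_of_int m < 1 \<longleftrightarrow> m = - \<lfloor>a $ i\<rfloor>" for i m
    using floor_eq_iff[of "a $ i" "- m"] by auto
  then have "a + real_vec v \<in> unit_cube \<longleftrightarrow> v = v0" for v
    by (simp add: unit_cube_def v0_def real_vec_def vec_eq_iff)
  then have "(indicator unit_cube (a + real_vec v) :: ennreal) = indicator {v0} v" for v
    by (auto simp: indicator_def)
  then show ?thesis by simp
qed

lemma measurable_real_vec [measurable]: "real_vec \<in> measurable (count_space UNIV) borel"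
  by simp

lemma nn_integral_unit_cube_translates:
  fixes f :: "real^'n \<Rightarrow> ennreal"
  assumes [measurable]: "f \<in> borel_measurable borel"
  shows "(\<integral>\<^sup>+v. \<integral>\<^sup>+z. indicator unit_cube z * f (a - real_vec v + z) \<partial>lborel \<partial>count_space UNIV)
    = (\<integral>\<^sup>+z. f z \<partial>lborel)"
proof -
  interpret L: pair_sigma_finite "count_space (UNIV :: (int^'n) set)" "lborel :: (real^'n) measure"
    by (intro pair_sigma_finite.intro sigma_finite_measure_count_space_countable sigma_finite_lborel) simp
  have "(\<integral>\<^sup>+z. indicator unit_cube z * f (a - real_vec v + z) \<partial>lborel)
      = (\<integral>\<^sup>+z. indicator unit_cube (- a + z + real_vec v) * f z \<partial>lborel)" for v
  proof -
    have "(\<integral>\<^sup>+z. indicator unit_cube z * f (a - real_vec v + z) \<partial>lborel)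
      = (\<integral>\<^sup>+z. indicator unit_cube z * f (a - real_vec v + z) \<partial>distr lborel borel ((+) (real_vec v - a)))"
      by (simp add: lborel_distr_plus)
    also have "\<dots> = (\<integral>\<^sup>+z. indicator unit_cube (- a + z + real_vec v) * f z \<partial>lborel)"
      by (subst nn_integral_distr) (auto simp: algebra_simps)
    finally show ?thesis .
  qed
  then have "(\<integral>\<^sup>+v. \<integral>\<^sup>+z. indicator unit_cube z * f (a - real_vec v + z) \<partial>lborel \<partial>count_space UNIV)
    = (\<integral>\<^sup>+v. \<integral>\<^sup>+z. indicator unit_cube (- a + z + real_vec v) * f z \<partial>lborel \<partial>count_space UNIV)"
    by simp
  also have "\<dots> = (\<integral>\<^sup>+z. \<integral>\<^sup>+v. indicator unit_cube (- a + z + real_vec v) * f z \<partial>count_space UNIV \<partial>lborel)"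
    by (rule L.Fubini'[symmetric]) measurable
  also have "\<dots> = (\<integral>\<^sup>+z. f z \<partial>lborel)"
    by (simp add: nn_integral_multc unit_cube_tiling)
  finally show ?thesis .
qed

text \<open>
  The sum over all integer vectors \<open>v\<close> of the distributions of \<open>X - v\<close>.
\<close>
definition periodization :: "'a measure \<Rightarrow> ('a \<Rightarrow> real^'n) \<Rightarrow> (real^'n) measure" where
  "periodization M X = distr (count_space UNIV \<Otimes>\<^sub>M M) borel (\<lambda>(v, x). X x - real_vec v)"

lemma measurable_periodization_map:
  assumes [measurable]: "X \<in> borel_measurable M"
  shows "(\<lambda>(v, x). X x - real_vec v) \<in> borel_measurable (count_space UNIV \<Otimes>\<^sub>M M)"
  by measurable

lemma nn_integral_periodization:
  assumes M: "sigma_finite_measure M" and [measurable]: "X \<in> borel_measurable M" "f \<in> borel_measurable borel"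
  shows "(\<integral>\<^sup>+y. f y \<partial>periodization M X) = (\<integral>\<^sup>+v. \<integral>\<^sup>+x. f (X x - real_vec v) \<partial>M \<partial>count_space UNIV)"
  unfolding periodization_def
  by (subst nn_integral_distr[OF measurable_periodization_map])
    (auto simp: sigma_finite_measure.nn_integral_fst[OF M, symmetric])

lemma emeasure_periodization:
  assumes M: "sigma_finite_measure M" and [measurable]: "X \<in> borel_measurable M" "E \<in> sets borel"
  shows "emeasure (periodization M X) E = (\<integral>\<^sup>+v. emeasure M {x \<in> space M. X x - real_vec v \<in> E} \<partial>count_space UNIV)"
proof -
  have ind: "(\<integral>\<^sup>+x. indicator E (X x - real_vec v) \<partial>M) = emeasure M {x \<in> space M. X x - real_vec v \<in> E}" for v
  proof -
    have "(\<integral>\<^sup>+x. indicator E (X x - real_vec v) \<partial>M)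
        = (\<integral>\<^sup>+x. indicator {x \<in> space M. X x - real_vec v \<in> E} x \<partial>M)"
      by (intro nn_integral_cong) (simp add: indicator_def)
    then show ?thesis by simp
  qed
  have "emeasure (periodization M X) E = (\<integral>\<^sup>+y. indicator E y \<partial>periodization M X)"
    by (simp add: periodization_def)
  also have "\<dots> = (\<integral>\<^sup>+v. \<integral>\<^sup>+x. indicator E (X x - real_vec v) \<partial>M \<partial>count_space UNIV)"
    by (rule nn_integral_periodization[OF M]) measurable
  finally show ?thesis by (simp only: ind)
qed

text \<open>
  Averaging an integer-periodic measure over the translations by a fundamental cube spreads it out
  evenly, whatever the distribution of \<open>X\<close> is.
\<close>
lemma periodization_average:
  fixes X :: "'a \<Rightarrow> real^'n"
  assumes "prob_space M" and [measurable]: "X \<in> borel_measurable M" "f \<in> borel_measurable borel"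
  shows "(\<integral>\<^sup>+z. indicator unit_cube z * (\<integral>\<^sup>+y. f (y + z) \<partial>periodization M X) \<partial>lborel) = (\<integral>\<^sup>+z. f z \<partial>lborel)"
proof -
  interpret M: prob_space M by fact
  interpret V: sigma_finite_measure "count_space (UNIV :: (int^'n) set)"
    by (intro sigma_finite_measure_count_space_countable) simp
  interpret VM: pair_sigma_finite "count_space (UNIV :: (int^'n) set)" M ..
  interpret VML: pair_sigma_finite "count_space (UNIV :: (int^'n) set) \<Otimes>\<^sub>M M" "lborel :: (real^'n) measure" ..
  let ?V = "count_space (UNIV :: (int^'n) set)"
  let ?g = "\<lambda>v x z. indicator unit_cube z * f (X x - real_vec v + z)"
  have "(\<integral>\<^sup>+z. indicator unit_cube z * (\<integral>\<^sup>+y. f (y + z) \<partial>periodization M X) \<partial>lborel)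
      = (\<integral>\<^sup>+z. \<integral>\<^sup>+p. ?g (fst p) (snd p) z \<partial>(?V \<Otimes>\<^sub>M M) \<partial>lborel)"
    unfolding periodization_def
    by (subst nn_integral_distr[OF measurable_periodization_map])
      (auto simp: nn_integral_cmult[symmetric] case_prod_unfold)
  also have "\<dots> = (\<integral>\<^sup>+p. \<integral>\<^sup>+z. ?g (fst p) (snd p) z \<partial>lborel \<partial>(?V \<Otimes>\<^sub>M M))"
    by (rule VML.Fubini') measurable
  also have "\<dots> = (\<integral>\<^sup>+v. \<integral>\<^sup>+x. \<integral>\<^sup>+z. ?g v x z \<partial>lborel \<partial>M \<partial>?V)"
    by (subst M.nn_integral_fst[symmetric]) auto
  also have "\<dots> = (\<integral>\<^sup>+x. \<integral>\<^sup>+v. \<integral>\<^sup>+z. ?g v x z \<partial>lborel \<partial>?V \<partial>M)"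
    by (rule VM.Fubini'[symmetric]) measurable
  also have "\<dots> = (\<integral>\<^sup>+x. (\<integral>\<^sup>+z. f z \<partial>lborel) \<partial>M)"
    by (simp add: nn_integral_unit_cube_translates)
  also have "\<dots> = (\<integral>\<^sup>+z. f z \<partial>lborel)"
    by (simp add: M.emeasure_space_1)
  finally show ?thesis .
qed

text \<open>
  Invariance under a dense set of translations already forces the periodization to be Lebesgue
  measure.  On an open set Fatou's lemma extends the invariance to all translations, at first as an
  inequality and then, by translating back, as an equality.  Averaging over the unit cube thus does
  not change the measure of an open set, but it yields its Lebesgue measure.
\<close>
lemma periodization_eq_lborel:
  fixes X :: "'a \<Rightarrow> real^'n"
  assumes M: "prob_space M" and X: "X \<in> borel_measurable M"
    and G: "\<And>z. \<exists>g. g \<longlonglongrightarrow> z \<and> (\<forall>k::nat. \<forall>f\<in>borel_measurable borel.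
      (\<integral>\<^sup>+y. f (y + g k) \<partial>periodization M X) = (\<integral>\<^sup>+y. f y \<partial>periodization M X))"
  shows "periodization M X = lborel"
proof -
  let ?P = "periodization M X"
  have sets_P [measurable_cong, simp]: "sets ?P = sets borel" by (simp add: periodization_def)
  have translate: "(\<integral>\<^sup>+y. indicator U (y + z) \<partial>?P) \<le> (\<integral>\<^sup>+y. indicator U y \<partial>?P)"
    if "open U" for U and z :: "real^'n"
  proof -
    have [measurable]: "U \<in> sets borel" using that by simp
    obtain g where g: "g \<longlonglongrightarrow> z" "\<And>k f. f \<in> borel_measurable borel \<Longrightarrow>
      (\<integral>\<^sup>+y. f (y + g k) \<partial>?P) = (\<integral>\<^sup>+y. f y \<partial>?P)" using G[of z] by blast
    have "indicator U (y + z) \<le> liminf (\<lambda>k. indicator U (y + g k) :: ennreal)" for y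
    proof (cases "y + z \<in> U")
      case True
      have "(\<lambda>k. y + g k) \<longlonglongrightarrow> y + z" by (intro tendsto_intros g)
      then have "\<forall>\<^sub>F k in sequentially. y + g k \<in> U"
        using True that topological_tendstoD by blast
      then have "\<forall>\<^sub>F k in sequentially. (1::ennreal) \<le> indicator U (y + g k)"
        by eventually_elim simp
      then show ?thesis using True by (simp add: Liminf_bounded)
    qed simp
    then have "(\<integral>\<^sup>+y. indicator U (y + z) \<partial>?P) \<le> (\<integral>\<^sup>+y. liminf (\<lambda>k. indicator U (y + g k)) \<partial>?P)"
      by (rule nn_integral_mono)
    also have "\<dots> \<le> liminf (\<lambda>k. \<integral>\<^sup>+y. indicator U (y + g k) \<partial>?P)"
      by (rule nn_integral_liminf) measurable
    also have "\<dots> = liminf (\<lambda>k. \<integral>\<^sup>+y. indicator U y \<partial>?P)"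
      by (subst g(2)) auto
    finally show ?thesis by (simp add: Liminf_const)
  qed
  have eq: "(\<integral>\<^sup>+y. indicator U (y + z) \<partial>?P) = (\<integral>\<^sup>+y. indicator U y \<partial>?P)"
    if "open U" for U and z :: "real^'n"
  proof (rule antisym[OF translate[OF that]])
    let ?W = "{y. y + z \<in> U}"
    have "open ?W"
      using open_vimage[OF that, of "\<lambda>y. y + z"] by (simp add: vimage_def continuous_intros)
    from translate[OF this, of "- z"]
    show "(\<integral>\<^sup>+y. indicator U y \<partial>?P) \<le> (\<integral>\<^sup>+y. indicator U (y + z) \<partial>?P)"
      by (simp add: indicator_def)
  qed
  have "lborel = ?P"
  proof (rule lborel_eqI)
    fix l u :: "real^'n" assume lu: "\<And>b. b \<in> Basis \<Longrightarrow> l \<bullet> b \<le> u \<bullet> b"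
    have "emeasure ?P (box l u) = (\<integral>\<^sup>+y. indicator (box l u) y \<partial>?P)" by simp
    also have "\<dots> = (\<integral>\<^sup>+z. indicator (unit_cube :: (real^'n) set) z * (\<integral>\<^sup>+y. indicator (box l u) y \<partial>?P) \<partial>lborel)"
      by (simp add: nn_integral_multc emeasure_unit_cube)
    also have "\<dots> = (\<integral>\<^sup>+z. indicator (unit_cube :: (real^'n) set) z * (\<integral>\<^sup>+y. indicator (box l u) (y + z) \<partial>?P) \<partial>lborel)"
      by (simp add: eq[OF open_box])
    also have "\<dots> = (\<integral>\<^sup>+z. indicator (box l u) z \<partial>lborel)"
      by (rule periodization_average[OF M X]) simp
    also have "\<dots> = emeasure lborel (box l u)" by simp
    finally show "emeasure ?P (box l u) = (\<Prod>b\<in>Basis. (u - l) \<bullet> b)" using lu by simp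
  qed simp
  then show ?thesis by simp
qed

section \<open>The periodized digit expansion is Lebesgue measure\<close>

abbreviation lattice_measure :: "int^'n^'n \<Rightarrow> (int^'n) set \<Rightarrow> (real^'n) measure" where
  "lattice_measure A C \<equiv> periodization (bernoulli C) (radix A)"

lemma bij_coset_transversal:
  fixes A :: "int^'n^'n"
  assumes A: "expanding A" and C: "coset_transversal A C"
  shows "bij_betw (\<lambda>(v, c). A *v v - c) (UNIV \<times> C) UNIV"
proof (rule bij_betwI')
  fix p q :: "(int^'n) \<times> (int^'n)" assume "p \<in> UNIV \<times> C" "q \<in> UNIV \<times> C"
  then obtain v c v' c' where p: "p = (v, c)" "q = (v', c')" "c \<in> C" "c' \<in> C" by auto
  show "((case p of (v, c) \<Rightarrow> A *v v - c) = (case q of (v, c) \<Rightarrow> A *v v - c)) = (p = q)"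
  proof
    assume "(case p of (v, c) \<Rightarrow> A *v v - c) = (case q of (v, c) \<Rightarrow> A *v v - c)"
    then have eq: "A *v v - c = A *v v' - c'" by (simp add: p)
    then have "c - c' = A *v (v - v')" by (simp add: matrix_vector_mult_diff_distrib algebra_simps)
    then have "same_coset A c c'" by (simp add: same_coset_def)
    moreover have "same_coset A c c"
      unfolding same_coset_def by (rule range_eqI[of _ _ 0]) simp
    ultimately have cc: "c = c'" using C p(3,4) unfolding coset_transversal_def by blast
    then have "real_mat A *v real_vec v = real_mat A *v real_vec v'"
      using eq by (simp flip: real_vec_simps)
    then have "real_vec v = real_vec v'"
      using real_mat_contraction(2)[OF A] by metis
    then have "v = v'" by (rule injD[OF inj_real_vec])
    then show "p = q" using cc p by simp
  qed simp
next
  fix u :: "int^'n"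
  obtain c where c: "c \<in> C" "same_coset A (- u) c" using C unfolding coset_transversal_def by blast
  then obtain v where v: "- u - c = A *v v" unfolding same_coset_def by blast
  have "A *v (- v) = - (A *v v)"
    using matrix_vector_mult_diff_distrib[of A 0 v] by simp
  moreover have "u = - (- u - c) - c" by simp
  ultimately have "u = A *v (- v) - c" by (simp only: v)
  then show "\<exists>p\<in>UNIV \<times> C. u = (case p of (v, c) \<Rightarrow> A *v v - c)"
    using c(1) by (intro bexI[of _ "(- v, c)"]) auto
qed auto

text \<open>
  Splitting off the first digit \<open>c\<close> turns the translate by \<open>v\<close> into the image under \<open>A\<^sup>-\<^sup>1\<close> of the
  translate by \<open>A v - c\<close>.  For a transversal \<open>C\<close> these vectors run through the whole lattice once,
  so the lattice measure reproduces itself under \<open>A\<^sup>-\<^sup>1\<close> up to the factor \<open>card C\<close>.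
\<close>
lemma lattice_measure_contraction:
  fixes A :: "int^'n^'n"
  assumes A: "expanding A" and C: "finite C" "coset_transversal A C"
    and f [measurable]: "f \<in> borel_measurable borel"
  shows "(\<integral>\<^sup>+y. f y \<partial>lattice_measure A C) = ennreal (1 / card C) * (\<integral>\<^sup>+y. f (contraction A y) \<partial>lattice_measure A C)"
proof -
  have C0: "C \<noteq> {}" using C(2) unfolding coset_transversal_def by blast
  interpret prob_space "bernoulli C" by (rule prob_space_bernoulli[OF C(1) C0])
  define H where "H u = (\<integral>\<^sup>+x. f (contraction A (radix A x - real_vec u)) \<partial>bernoulli C)" for u
  have "(\<integral>\<^sup>+x. f (radix A x - real_vec v) \<partial>bernoulli C) = (\<Sum>c\<in>C. ennreal (1 / card C) * H (A *v v - c))" for v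
  proof -
    have "(\<integral>\<^sup>+x. f (radix A (case_nat c x) - real_vec v) \<partial>bernoulli C) = H (A *v v - c)" if "c \<in> C" for c
      unfolding H_def
    proof (rule nn_integral_cong)
      fix x assume "x \<in> space (bernoulli C)"
      then have "range (case_nat c x) \<subseteq> C"
        using \<open>c \<in> C\<close> by (auto simp: space_bernoulli image_subset_iff split: nat.splits)
      from radix_unfold[OF A C(1) this]
      have "radix A (case_nat c x) = contraction A (real_vec c + radix A x)" by simp
      moreover have "real_vec v = contraction A (real_vec (A *v v))"
        using real_mat_contraction(2)[OF A] by simp
      ultimately have "radix A (case_nat c x) - real_vec v = contraction A (radix A x - real_vec (A *v v - c))"
        by (simp add: linear_diff[OF linear_contraction] linear_add[OF linear_contraction])
      then show "f (radix A (case_nat c x) - real_vec v) = f (contraction A (radix A x - real_vec (A *v v - c)))"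
        by simp
    qed
    then show ?thesis
      by (subst nn_integral_bernoulli_unfold[OF C(1) C0]) auto
  qed
  then have "(\<integral>\<^sup>+y. f y \<partial>lattice_measure A C)
      = (\<integral>\<^sup>+v. (\<Sum>c\<in>C. ennreal (1 / card C) * H (A *v v - c)) \<partial>count_space UNIV)"
    by (simp add: nn_integral_periodization[OF sigma_finite_measure_axioms])
  also have "\<dots> = ennreal (1 / card C) * (\<integral>\<^sup>+v. \<integral>\<^sup>+c. H (A *v v - c) \<partial>count_space C \<partial>count_space UNIV)"
    by (simp add: sum_distrib_left[symmetric] nn_integral_cmult nn_integral_count_space_finite[OF C(1)])
  also have "(\<integral>\<^sup>+v. \<integral>\<^sup>+c. H (A *v v - c) \<partial>count_space C \<partial>count_space UNIV)
      = (\<integral>\<^sup>+p. H (case p of (v, c) \<Rightarrow> A *v v - c) \<partial>count_space (UNIV \<times> C))"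
  proof -
    interpret sigma_finite_measure "count_space C"
      by (intro sigma_finite_measure_count_space_countable countable_finite C)
    show ?thesis
      using nn_integral_fst[of "\<lambda>p. H (case p of (v, c) \<Rightarrow> A *v v - c)" "count_space UNIV"]
      by (simp add: pair_measure_countable countable_finite C(1))
  qed
  also have "\<dots> = (\<integral>\<^sup>+u. H u \<partial>count_space UNIV)"
    by (rule nn_integral_bij_count_space[OF bij_coset_transversal[OF A C(2)]])
  also have "\<dots> = (\<integral>\<^sup>+y. f (contraction A y) \<partial>lattice_measure A C)"
    by (simp add: nn_integral_periodization[OF sigma_finite_measure_axioms] H_def)
  finally show ?thesis .
qed

lemma periodization_translate_integer:
  fixes X :: "'a \<Rightarrow> real^'n"
  assumes M: "sigma_finite_measure M" and [measurable]: "X \<in> borel_measurable M" "f \<in> borel_measurable borel"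
  shows "(\<integral>\<^sup>+y. f (y + real_vec u) \<partial>periodization M X) = (\<integral>\<^sup>+y. f y \<partial>periodization M X)"
proof -
  have "bij_betw (\<lambda>v. v - u) UNIV UNIV"
    by (rule bij_betwI[where g = "\<lambda>v. v + u"]) auto
  from nn_integral_bij_count_space[OF this, of "\<lambda>v. \<integral>\<^sup>+x. f (X x - real_vec v) \<partial>M"]
  show ?thesis
    by (simp add: nn_integral_periodization[OF M] algebra_simps)
qed

text \<open>
  Invariance under the integer lattice is carried to the finer lattices \<open>A\<^sup>-\<^sup>k \<int>\<^sup>n\<close> by the scaling
  identity.
\<close>
lemma lattice_measure_translate:
  fixes A :: "int^'n^'n"
  assumes A: "expanding A" and C: "finite C" "coset_transversal A C"
    and f: "f \<in> borel_measurable borel"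
  shows "(\<integral>\<^sup>+y. f (y + (contraction A ^^ k) (real_vec u)) \<partial>lattice_measure A C) = (\<integral>\<^sup>+y. f y \<partial>lattice_measure A C)"
  using f
proof (induction k arbitrary: f)
  case 0
  have "C \<noteq> {}" using C(2) unfolding coset_transversal_def by blast
  then interpret prob_space "bernoulli C" by (rule prob_space_bernoulli[OF C(1)])
  show ?case
    using periodization_translate_integer[OF sigma_finite_measure_axioms measurable_radix 0] by simp
next
  case (Suc k)
  note [measurable] = Suc.prems
  have "(\<integral>\<^sup>+y. f (y + (contraction A ^^ Suc k) (real_vec u)) \<partial>lattice_measure A C)
      = ennreal (1 / card C) * (\<integral>\<^sup>+y. f (contraction A (y + (contraction A ^^ k) (real_vec u))) \<partial>lattice_measure A C)"
    by (subst lattice_measure_contraction[OF A C]) (simp_all add: linear_add[OF linear_contraction])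
  also have "\<dots> = ennreal (1 / card C) * (\<integral>\<^sup>+y. f (contraction A y) \<partial>lattice_measure A C)"
    by (subst Suc.IH) auto
  also have "\<dots> = (\<integral>\<^sup>+y. f y \<partial>lattice_measure A C)"
    by (rule lattice_measure_contraction[OF A C Suc.prems, symmetric])
  finally show ?case .
qed

text \<open>
  Round \<open>A\<^sup>k z\<close> to an integer vector and map back: the rounding error is bounded, so its image
  tends to 0.
\<close>
lemma contraction_lattices_dense:
  fixes A :: "int^'n^'n" and z :: "real^'n"
  assumes A: "expanding A"
  obtains u where "(\<lambda>k. (contraction A ^^ k) (real_vec (u k))) \<longlonglongrightarrow> z"
proof -
  define p where "p k = (((*v) (real_mat A)) ^^ k) z" for k
  define u where "u k = (\<chi> i. \<lfloor>p k $ i\<rfloor>)" for k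
  define y where "y k = p k - real_vec (u k)" for k
  have z: "(contraction A ^^ k) (p k) = z" for k
  proof (induction k)
    case (Suc k)
    have "p (Suc k) = real_mat A *v p k" by (simp add: p_def)
    with Suc show ?case by (simp add: funpow_Suc_right real_mat_contraction[OF A] del: funpow.simps)
  qed (simp add: p_def)
  have "norm (y k) \<le> real CARD('n)" for k
  proof -
    have "\<bar>y k $ i\<bar> \<le> 1" for i
      by (simp add: y_def u_def real_vec_def) linarith
    then have "(\<Sum>i\<in>UNIV. \<bar>y k $ i\<bar>) \<le> (\<Sum>i\<in>(UNIV::'n set). 1)" by (intro sum_mono)
    then show ?thesis using norm_le_l1_cart[of "y k"] by simp
  qed
  from tendsto_diff[OF tendsto_const[of z] contraction_funpow_bounded_tendsto_0[where y = y, OF A this]]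
  have "(\<lambda>k. (contraction A ^^ k) (real_vec (u k))) \<longlonglongrightarrow> z"
    by (simp add: y_def linear_diff[OF linear_contraction_funpow] z)
  then show ?thesis using that by blast
qed

lemma lattice_measure_eq_lborel:
  assumes A: "expanding A" and C: "finite C" "coset_transversal A C"
  shows "lattice_measure A C = lborel"
proof (rule periodization_eq_lborel)
  have "C \<noteq> {}" using C(2) unfolding coset_transversal_def by blast
  then show "prob_space (bernoulli C)" by (rule prob_space_bernoulli[OF C(1)])
  fix z
  obtain u where "(\<lambda>k. (contraction A ^^ k) (real_vec (u k))) \<longlonglongrightarrow> z"
    using contraction_lattices_dense[OF A] .
  then show "\<exists>g. g \<longlonglongrightarrow> z \<and> (\<forall>k::nat. \<forall>f\<in>borel_measurable borel.
      (\<integral>\<^sup>+y. f (y + g k) \<partial>lattice_measure A C) = (\<integral>\<^sup>+y. f y \<partial>lattice_measure A C))"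
    using lattice_measure_translate[OF A C] by (intro exI conjI) auto
qed (rule measurable_radix)

theorem theorem1:
  fixes A :: "int^'n^'n" and D K C :: "(int^'n) set"
  assumes "expanding A"
    and "finite D" and "D \<noteq> {}"
    and "if represents_all_cosets A D then K = D
         else finite K \<and> D \<subseteq> K \<and> represents_all_cosets A K"
    and "C \<subseteq> K" and "coset_transversal A C"
  shows "emeasure lebesgue (self_affine_set A D) =
         (\<Sum>\<^sub>\<infinity>v\<in>nucleus_verts A K. emeasure (bernoulli C) (F A K C D v))"
proof -
  note A = assms(1)
  have K: "finite K" "D \<subseteq> K" using assms(2,4) by (auto split: if_splits)
  have C: "finite C" using assms(5) K(1) finite_subset by blast
  have "C \<noteq> {}" using assms(6) unfolding coset_transversal_def by blast
  then interpret prob_space "bernoulli C" by (rule prob_space_bernoulli[OF C])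
  let ?T = "self_affine_set A D"
  have T: "?T \<in> sets borel"
    using compact_self_affine_set[OF A assms(2)] by (simp add: borel_compact)
  define B where "B v = {x \<in> space (bernoulli C). radix A x - real_vec v \<in> ?T}" for v
  have B_iff: "x \<in> B v \<longleftrightarrow> range x \<subseteq> C \<and> radix A x - real_vec v \<in> ?T" for x v
    by (simp add: B_def space_bernoulli)
  have F: "F A K C D v = B v" for v
  proof (intro set_eqI iffI)
    show "x \<in> B v" if "x \<in> F A K C D v" for x
      unfolding B_iff using F_subset_radix_translate[OF A K assms(5) that] by (rule conjI)
    show "x \<in> F A K C D v" if "x \<in> B v" for x
      using that unfolding B_iff by (elim conjE) (rule radix_translate_subset_F(2)[OF A K assms(5)])
  qed
  have B: "B v = {}" if "v \<notin> nucleus_verts A K" for v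
  proof (rule equals0I)
    fix x assume "x \<in> B v"
    then show False
      unfolding B_iff using radix_translate_subset_F(1)[OF A K assms(5), of x v] that by simp
  qed
  have "emeasure lebesgue ?T = emeasure (lattice_measure A C) ?T"
    using T by (simp add: lattice_measure_eq_lborel[OF A C assms(6)])
  also have "\<dots> = (\<integral>\<^sup>+v. emeasure (bernoulli C) (B v) \<partial>count_space UNIV)"
    unfolding B_def by (rule emeasure_periodization[OF sigma_finite_measure_axioms measurable_radix T])
  also have "\<dots> = (\<Sum>v\<in>nucleus_verts A K. emeasure (bernoulli C) (B v))"
    by (rule nn_integral_count_space'[OF finite_nucleus_verts[OF A K(1)]]) (use B in auto)
  also have "\<dots> = (\<Sum>\<^sub>\<infinity>v\<in>nucleus_verts A K. emeasure (bernoulli C) (F A K C D v))"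
    by (simp add: F infsum_finite[OF finite_nucleus_verts[OF A K(1)]])
  finally show ?thesis .
qed

end
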